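(* There exist positive absolute constants $c_{\mathcal B}$ and $c_{\mathcal C}$ (independent of $N,p,q$) such that for every integer $N\ge 1$ and all $p,q\in[1,\infty]$ (with the convention $1/\infty=0$) the following hold: (i) if $\frac12\le\frac1p\le 1$ and $1-\frac1p\le\frac1q\le 1$, then $C_N(p\to q)=1$; (ii) if $0\le\frac1q\le\frac12$ and $0\le\frac1p\le 1-\frac1q$, then $c_{\mathcal B}\,N^{1-\frac1q-\frac1p}\le C_N(p\to q)\le N^{1-\frac1q-\frac1p}$; (iii) if $0\le\frac1p\le\frac12$ and $\frac12\le\frac1q\le1$, then $c_{\mathcal C}\,N^{\frac12-\frac1p}\le C_N(p\to q)\le N^{\frac12-\frac1p}$.
   Context: For $a=(a_0,\dots,a_{N-1})\in\mathbb C^N$ let $T_N(a)$ be the function $f(t)=\sum_{n=0}^{N-1}a_n e^{\mathrm i n t}$ on $[-\pi,\pi]$. Norms: $\|a\|_{\ell^p}=\big(\sum_{n=0}^{N-1}|a_n|^p\big)^{1/p}$ for $1\le p<\infty$, $\|a\|_{\ell^\infty}=\max_n|a_n|$; $\|f\|_{L^q}=\big(\frac1{2\pi}\int_{-\pi}^{\pi}|f(t)|^q\,dt\big)^{1/q}$ for $1\le q<\infty$ (normalized measure), $\|f\|_{L^\infty}=\max_{|t|\le\pi}|f(t)|$. The constant $C_N(p\to q)$ is the operator norm $$C_N(p\to q)=\sup_{a\in\mathbb C^N\setminus\{0\}}\frac{\|T_N(a)\|_{L^q}}{\|a\|_{\ell^p}}.$$ *)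

theory Defs
  imports "HOL-Analysis.Analysis"
begin

text \<open>
  Exponents range over \<open>{1..\<infinity>}\<close> in \<^typ>\<open>ereal\<close>. A vector of \<open>\<complex>\<^sup>N\<close> is a function
  \<^typ>\<open>nat \<Rightarrow> complex\<close> of which only the entries with index below \<open>N\<close> are used.
\<close>

definition recip :: "ereal \<Rightarrow> real" where
  "recip p = real_of_ereal (1 / p)"

lemma recip_infinity [simp]: "recip \<infinity> = 0"
  by (simp add: recip_def)

lemma recip_ereal: "r \<noteq> 0 \<Longrightarrow> recip (ereal r) = 1 / r"
  by (simp add: recip_def one_ereal_def)

definition T :: "nat \<Rightarrow> (nat \<Rightarrow> complex) \<Rightarrow> real \<Rightarrow> complex" where
  "T N a t = (\<Sum>n<N. a n * exp (\<i> * of_nat n * of_real t))"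

definition seq_norm :: "nat \<Rightarrow> ereal \<Rightarrow> (nat \<Rightarrow> complex) \<Rightarrow> real" where
  "seq_norm N p a =
    (if p = \<infinity> then Max ((\<lambda>n. cmod (a n)) ` {..<N})
     else (\<Sum>n<N. cmod (a n) powr real_of_ereal p) powr recip p)"

text \<open>
  \<open>fun_norm\<close> is only applied to continuous functions: the integral below then coincides with
  the Lebesgue integral, and the supremum is a maximum.
\<close>

definition fun_norm :: "ereal \<Rightarrow> (real \<Rightarrow> complex) \<Rightarrow> real" where
  "fun_norm q f =
    (if q = \<infinity> then (SUP t\<in>{-pi..pi}. cmod (f t))
     else (1 / (2 * pi) * integral {-pi..pi} (\<lambda>t. cmod (f t) powr real_of_ereal q)) powr recip q)"

text \<open>
  The supremum is taken in \<^typ>\<open>ereal\<close>, so that an upper bound on \<open>C N p q\<close> also asserts that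
  the set of quotients is bounded; \<^const>\<open>Sup\<close> on \<^typ>\<open>real\<close> is unspecified for unbounded sets.
\<close>

definition C :: "nat \<Rightarrow> ereal \<Rightarrow> ereal \<Rightarrow> ereal" where
  "C N p q = (SUP a\<in>{a. \<exists>n<N. a n \<noteq> 0}. ereal (fun_norm q (T N a) / seq_norm N p a))"

end

theory Submission
  imports Defs "HOL-Complex_Analysis.Conformal_Mappings"
begin

text \<open>
  All upper bounds follow from the Hausdorff--Young inequality, since \<open>fun_norm q\<close> increases in
  \<open>q\<close> and the norms \<open>seq_norm N p\<close> compare by the power mean inequality. Hausdorff--Young is
  reduced to finite sums: at the \<open>N\<close> points \<open>t + 2\<pi>j/N\<close> the matrix of \<open>T N\<close> is unitary up to a
  scalar, so the three lines theorem applied to a finite sum of exponentials yields the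
  inequality for the mean over these points, and integrating over \<open>t\<close> gives the inequality for
  \<open>T N a\<close>. The lower bounds are witnessed by a single coefficient, by the Dirichlet kernel (large
  on \<open>[0, 1/N]\<close>), and by a Rudin--Shapiro polynomial, whose small supremum forces a large mean.
\<close>

section \<open>The three lines theorem and bilinear interpolation\<close>

text \<open>On the strip the factor \<open>exp (\<epsilon> * (z\<^sup>2 - 1))\<close> has modulus at
  most \<open>exp (- (\<epsilon> * (Im z)\<^sup>2))\<close>. It makes \<open>F\<close> small on the
  horizontal sides of a tall rectangle, where the maximum modulus principle applies; then
  \<open>\<epsilon>\<close> tends to 0.\<close>

lemma three_lines:
  fixes F :: "complex \<Rightarrow> complex"
  assumes hol: "F holomorphic_on {z. 0 < Re z \<and> Re z < 1}"
    and cont: "continuous_on {z. 0 \<le> Re z \<and> Re z \<le> 1} F"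
    and bound: "\<And>z. 0 \<le> Re z \<Longrightarrow> Re z \<le> 1 \<Longrightarrow> cmod (F z) \<le> B"
    and edge: "\<And>z. Re z = 0 \<or> Re z = 1 \<Longrightarrow> cmod (F z) \<le> M"
    and M: "M > 0" and \<xi>: "0 \<le> Re \<xi>" "Re \<xi> \<le> 1"
  shows "cmod (F \<xi>) \<le> M"
proof -
  have B: "0 \<le> B" using bound[OF \<xi>] norm_ge_zero order_trans by blast
  have damped: "cmod (F \<xi>) * exp (\<epsilon> * Re (\<xi>\<^sup>2 - 1)) \<le> M" if "\<epsilon> > 0" for \<epsilon> :: real
  proof -
    \<comment> \<open>The height serves the horizontal sides: \<open>R \<ge> 1\<close> turns
      \<open>B / (M * \<epsilon>) \<le> R\<close> into
      \<open>B \<le> M * (\<epsilon> * R\<^sup>2)\<close>, which is below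
      \<open>M * exp (\<epsilon> * R\<^sup>2)\<close>. The summand
      \<open>\<bar>Im \<xi>\<bar>\<close> keeps \<open>\<xi>\<close> in the rectangle.\<close>
    define R where "R = \<bar>Im \<xi>\<bar> + 1 + B / (M * \<epsilon>)"
    define S where "S = cbox (Complex 0 (- R)) (Complex 1 R)"
    define G where "G = (\<lambda>z. F z * exp (of_real \<epsilon> * (z\<^sup>2 - 1)))"
    have "0 \<le> B / (M * \<epsilon>)" using B M that by simp
    then have R: "R \<ge> 1" "\<bar>Im \<xi>\<bar> \<le> R" "B / (M * \<epsilon>) \<le> R" unfolding R_def by linarith+
    have normG: "cmod (G z) = cmod (F z) * exp (\<epsilon> * Re (z\<^sup>2 - 1))" for z
      by (simp add: G_def norm_mult)
    have re: "Re (z\<^sup>2 - 1) \<le> - (Im z)\<^sup>2" if "0 \<le> Re z" "Re z \<le> 1" for z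
    proof -
      have "(Re z)\<^sup>2 \<le> 1" using that by (simp add: power_le_one)
      then show ?thesis by (simp add: power2_eq_square)
    qed
    have "cmod (G \<xi>) \<le> M"
    proof (rule maximum_modulus_frontier[of G S])
      have "interior S \<subseteq> {z. 0 < Re z \<and> Re z < 1}" by (auto simp: S_def in_box_complex_iff)
      then show "G holomorphic_on interior S"
        unfolding G_def by (intro holomorphic_intros holomorphic_on_subset[OF hol])
      have "closure S \<subseteq> {z. 0 \<le> Re z \<and> Re z \<le> 1}" by (auto simp: S_def in_cbox_complex_iff)
      then show "continuous_on (closure S) G"
        unfolding G_def by (intro continuous_intros continuous_on_subset[OF cont])
      show "bounded S" by (simp add: S_def)
      show "\<xi> \<in> S" using \<xi> R by (auto simp: S_def in_cbox_complex_iff)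
      fix z assume "z \<in> frontier S"
      then have "z \<in> S" "z \<notin> box (Complex 0 (- R)) (Complex 1 R)"
        by (auto simp: S_def frontier_def)
      then have z: "0 \<le> Re z" "Re z \<le> 1" and zc: "Re z = 0 \<or> Re z = 1 \<or> \<bar>Im z\<bar> = R"
        by (auto simp: S_def in_cbox_complex_iff in_box_complex_iff)
      have "\<epsilon> * Re (z\<^sup>2 - 1) \<le> \<epsilon> * - (Im z)\<^sup>2"
        using re[OF z] \<open>\<epsilon> > 0\<close> by (intro mult_left_mono) auto
      then have e: "exp (\<epsilon> * Re (z\<^sup>2 - 1)) \<le> exp (- (\<epsilon> * (Im z)\<^sup>2))" by simp
      show "cmod (G z) \<le> M"
      proof (cases "Re z = 0 \<or> Re z = 1")
        case True
        have "exp (- (\<epsilon> * (Im z)\<^sup>2)) \<le> 1" using \<open>\<epsilon> > 0\<close> by simp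
        with e have "exp (\<epsilon> * Re (z\<^sup>2 - 1)) \<le> 1" by linarith
        then show ?thesis
          unfolding normG using edge[OF True] by (metis M less_le mult_mono mult.right_neutral exp_ge_zero)
      next
        case False
        then have "(Im z)\<^sup>2 = R\<^sup>2" using zc by (metis power2_abs)
        have "R * 1 \<le> R * R" using R(1) by (intro mult_left_mono) auto
        then have "B / (M * \<epsilon>) \<le> R\<^sup>2" using R(3) by (simp add: power2_eq_square)
        then have "B \<le> M * (\<epsilon> * R\<^sup>2)" using M \<open>\<epsilon> > 0\<close> by (simp add: field_simps)
        also have "\<dots> \<le> M * exp (\<epsilon> * R\<^sup>2)"
          using M order_trans[OF _ exp_ge_add_one_self] by (intro mult_left_mono) auto
        finally have "B * exp (- (\<epsilon> * R\<^sup>2)) \<le> M" by (simp add: exp_minus field_simps)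
        moreover have "cmod (G z) \<le> B * exp (- (\<epsilon> * R\<^sup>2))"
          unfolding normG using e \<open>(Im z)\<^sup>2 = R\<^sup>2\<close> bound[OF z] B by (intro mult_mono) auto
        ultimately show ?thesis by linarith
      qed
    qed
    then show ?thesis by (simp add: normG)
  qed
  have "((\<lambda>\<epsilon>. cmod (F \<xi>) * exp (\<epsilon> * Re (\<xi>\<^sup>2 - 1))) \<longlongrightarrow> cmod (F \<xi>) * exp (0 * Re (\<xi>\<^sup>2 - 1))) (at_right 0)"
    by (intro tendsto_intros)
  moreover have "eventually (\<lambda>\<epsilon>. cmod (F \<xi>) * exp (\<epsilon> * Re (\<xi>\<^sup>2 - 1)) \<le> M) (at_right 0)"
    using damped by (auto simp: eventually_at_right_field intro: exI[of _ 1])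
  ultimately show ?thesis
    using tendsto_upperbound by fastforce
qed

lemma powr_le_one_plus:
  fixes x s p :: real
  assumes "0 \<le> x" "0 \<le> s" "s \<le> p"
  shows "x powr s \<le> 1 + x powr p"
proof (cases "x \<le> 1")
  case True
  then have "x powr s \<le> 1" using assms by (intro powr_le1) auto
  then show ?thesis by (simp add: add_increasing2)
next
  case False
  then have "x powr s \<le> x powr p" using assms by (intro powr_mono) auto
  then show ?thesis by simp
qed

text \<open>The Riesz--Thorin argument, with mass \<open>w\<close> at each point of
  \<open>B\<close>. An analytic family through \<open>a\<close> and \<open>b\<close> has moduli
  \<open>cmod x powr Re (e z)\<close>: the exponent is \<open>p\<close> on the edge
  \<open>Re z = 0\<close>, where \<open>K1\<close> applies, and \<open>p / 2\<close> on
  \<open>Re z = 1\<close>, where \<open>K2\<close> applies. Normalization makes both edge bounds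
  1.\<close>

lemma bilinear_interpolation_normalized:
  fixes K :: "'a \<Rightarrow> 'b \<Rightarrow> complex" and p w :: real
  assumes fin: "finite A" "finite B" and p: "1 \<le> p" "p \<le> 2" and w: "0 < w"
    and K1: "\<And>i j. i \<in> A \<Longrightarrow> j \<in> B \<Longrightarrow> cmod (K i j) \<le> w"
    and K2: "\<And>a b. cmod (\<Sum>i\<in>A. \<Sum>j\<in>B. K i j * (a i * b j))
               \<le> sqrt (\<Sum>i\<in>A. (cmod (a i))\<^sup>2) * sqrt (w * (\<Sum>j\<in>B. (cmod (b j))\<^sup>2))"
    and a: "(\<Sum>i\<in>A. cmod (a i) powr p) = 1" and b: "w * (\<Sum>j\<in>B. cmod (b j) powr p) = 1"
  shows "cmod (\<Sum>i\<in>A. \<Sum>j\<in>B. K i j * (a i * b j)) \<le> 1"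
proof -
  \<comment> \<open>This is \<open>x\<close> with its modulus raised to the complex power
    \<open>z\<close>; for \<open>x = 0\<close> the factor \<open>sgn x\<close> makes it 0 for every
    \<open>z\<close>.\<close>
  define u :: "complex \<Rightarrow> complex \<Rightarrow> complex"
    where "u = (\<lambda>x z. sgn x * exp (of_real (ln (cmod x)) * z))"
  define e :: "complex \<Rightarrow> complex" where "e = (\<lambda>z. of_real p * (1 - z / 2))"
  define F where "F = (\<lambda>z. \<Sum>i\<in>A. \<Sum>j\<in>B. K i j * (u (a i) (e z) * u (b j) (e z)))"
  have norm_u: "cmod (u x z) = cmod x powr Re z" for x z
    by (cases "x = 0") (simp_all add: u_def norm_mult norm_sgn powr_def mult.commute)
  have u1: "u x 1 = x" for x
    by (cases "x = 0") (simp_all add: u_def sgn_eq flip: of_real_exp)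
  have Re_e: "Re (e z) = p * (1 - Re z / 2)" for z
    by (simp add: e_def)
  have bound: "cmod (F z) \<le> (\<Sum>i\<in>A. \<Sum>j\<in>B. w * (cmod (a i) powr Re (e z) * cmod (b j) powr Re (e z)))" for z
    unfolding F_def
    by (intro order_trans[OF norm_sum] sum_mono)
       (simp add: norm_mult norm_u K1 mult_right_mono)
  \<comment> \<open>At this point \<open>e\<close> equals 1, so \<open>F\<close> takes the value of
    the original form. The a priori bound passed to \<open>three_lines\<close> is independent of
    \<open>z\<close> because \<open>Re (e z)\<close> stays between 0 and \<open>p\<close>.\<close>
  have "cmod (F (of_real (2 - 2 / p))) \<le> 1"
  proof (rule three_lines[of F "\<Sum>i\<in>A. \<Sum>j\<in>B. w * ((1 + cmod (a i) powr p) * (1 + cmod (b j) powr p))"])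
    show "F holomorphic_on {z. 0 < Re z \<and> Re z < 1}"
      unfolding F_def u_def e_def by (intro holomorphic_intros) auto
    show "continuous_on {z. 0 \<le> Re z \<and> Re z \<le> 1} F"
      unfolding F_def u_def e_def by (intro continuous_intros) auto
    show "0 \<le> Re (of_real (2 - 2 / p))" "Re (of_real (2 - 2 / p)) \<le> 1"
      using p by (auto simp: field_simps)
    fix z assume z: "0 \<le> Re z" "Re z \<le> 1"
    have "0 \<le> Re (e z)" unfolding Re_e using z p by simp
    moreover have "Re (e z) \<le> p" unfolding Re_e using z p by (simp add: mult_left_le)
    ultimately show "cmod (F z) \<le> (\<Sum>i\<in>A. \<Sum>j\<in>B. w * ((1 + cmod (a i) powr p) * (1 + cmod (b j) powr p)))"
      using w by (intro order_trans[OF bound] sum_mono mult_left_mono mult_mono powr_le_one_plus) (auto intro: add_nonneg_nonneg)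
  next
    fix z assume "Re z = 0 \<or> Re z = 1"
    then show "cmod (F z) \<le> 1"
    proof
      assume "Re z = 0"
      then have "cmod (F z) \<le> (\<Sum>i\<in>A. \<Sum>j\<in>B. w * (cmod (a i) powr p * cmod (b j) powr p))"
        using bound[of z] by (simp add: Re_e)
      also have "\<dots> = (\<Sum>i\<in>A. cmod (a i) powr p) * (w * (\<Sum>j\<in>B. cmod (b j) powr p))"
        by (simp add: sum_product sum_distrib_left mult_ac, rule sum.swap)
      finally show ?thesis by (simp add: a b)
    next
      assume "Re z = 1"
      then have "(cmod (u x (e z)))\<^sup>2 = cmod x powr p" for x
        by (simp add: norm_u Re_e power2_eq_square flip: powr_add)
      then show ?thesis
        using K2[of "\<lambda>i. u (a i) (e z)" "\<lambda>j. u (b j) (e z)"] by (simp add: F_def a b)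
    qed
  qed simp
  moreover have "e (of_real (2 - 2 / p)) = 1"
    using p by (simp add: e_def field_simps)
  ultimately show ?thesis by (simp add: F_def u1)
qed

text \<open>By homogeneity, dividing \<open>a\<close> and \<open>b\<close> by their norms reduces to
  the normalized case; if one of the norms is 0, the form vanishes.\<close>

lemma bilinear_interpolation:
  fixes K :: "'a \<Rightarrow> 'b \<Rightarrow> complex" and p w :: real
  assumes fin: "finite A" "finite B" and p: "1 \<le> p" "p \<le> 2" and w: "0 < w"
    and K1: "\<And>i j. i \<in> A \<Longrightarrow> j \<in> B \<Longrightarrow> cmod (K i j) \<le> w"
    and K2: "\<And>a b. cmod (\<Sum>i\<in>A. \<Sum>j\<in>B. K i j * (a i * b j))
               \<le> sqrt (\<Sum>i\<in>A. (cmod (a i))\<^sup>2) * sqrt (w * (\<Sum>j\<in>B. (cmod (b j))\<^sup>2))"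
  shows "cmod (\<Sum>i\<in>A. \<Sum>j\<in>B. K i j * (a i * b j))
    \<le> (\<Sum>i\<in>A. cmod (a i) powr p) powr (1 / p) * (w * (\<Sum>j\<in>B. cmod (b j) powr p)) powr (1 / p)"
    (is "?l \<le> ?X powr _ * ?Y powr _")
proof (cases "?X = 0 \<or> ?Y = 0")
  case True
  then have "(\<forall>i\<in>A. a i = 0) \<or> (\<forall>j\<in>B. b j = 0)"
    using fin w by (auto simp: sum_nonneg_eq_0_iff)
  then have "?l = 0" by auto
  then show ?thesis by simp
next
  case False
  have XY: "?X > 0" "?Y > 0"
    using False w by (auto simp: less_le sum_nonneg)
  define \<alpha> \<beta> where "\<alpha> = ?X powr (1 / p)" and "\<beta> = ?Y powr (1 / p)"
  have pos: "\<alpha> > 0" "\<beta> > 0" using XY False by (auto simp: \<alpha>_def \<beta>_def)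
  have pw: "\<alpha> powr p = ?X" "\<beta> powr p = ?Y" using XY p by (auto simp: \<alpha>_def \<beta>_def powr_powr)
  have "cmod (\<Sum>i\<in>A. \<Sum>j\<in>B. K i j * ((a i / of_real \<alpha>) * (b j / of_real \<beta>))) \<le> 1"
  proof (rule bilinear_interpolation_normalized[OF fin p w K1 K2])
    show "(\<Sum>i\<in>A. cmod (a i / of_real \<alpha>) powr p) = 1"
      using XY pos by (simp add: norm_divide powr_divide pw flip: sum_divide_distrib)
    show "w * (\<Sum>j\<in>B. cmod (b j / of_real \<beta>) powr p) = 1"
      using XY pos False by (simp add: norm_divide powr_divide pw flip: sum_divide_distrib)
  qed
  also have "(\<Sum>i\<in>A. \<Sum>j\<in>B. K i j * ((a i / of_real \<alpha>) * (b j / of_real \<beta>)))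
      = (\<Sum>i\<in>A. \<Sum>j\<in>B. K i j * (a i * b j)) / of_real (\<alpha> * \<beta>)"
    by (simp add: sum_divide_distrib)
  finally show ?thesis
    using pos by (simp add: norm_divide norm_mult divide_le_eq \<alpha>_def \<beta>_def)
qed

section \<open>Finite Fourier analysis at equispaced points\<close>

text \<open>A geometric sum with ratio \<open>w\<close> and \<open>w ^ N = 1\<close>. The case
  \<open>w = 1\<close> would make \<open>N\<close> divide \<open>k\<close>, which the bound on
  \<open>k\<close> permits only for \<open>k = 0\<close>.\<close>

lemma sum_exp_equispaced:
  fixes k :: int
  assumes "\<bar>k\<bar> < int N"
  shows "(\<Sum>j<N. exp (\<i> * of_int k * of_real (2 * pi * real j / real N))) = (if k = 0 then of_nat N else 0)"
proof (cases "k = 0")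
  case False
  then have N: "N > 0" using assms by simp
  define w where "w = exp (\<i> * of_int k * of_real (2 * pi / real N))"
  have w: "exp (\<i> * of_int k * of_real (2 * pi * real j / real N)) = w ^ j" for j
    by (simp add: w_def flip: exp_of_nat_mult) (simp add: mult_ac)
  have "w ^ N = exp (of_int k * (2 * pi * \<i>))"
    using N by (simp add: w_def mult_ac flip: exp_of_nat_mult)
  also have "\<dots> = 1" by (simp add: exp_eq_1)
  finally have "w ^ N = 1" .
  moreover have "w \<noteq> 1"
  proof
    assume "w = 1"
    then obtain n :: int where "real_of_int k * (2 * pi / real N) = of_int (2 * n) * pi"
      by (auto simp: w_def exp_eq_1)
    then have "real_of_int k = of_int n * of_int (int N)" using N by (simp add: field_simps)
    then have "k = n * int N" by (metis of_int_eq_iff of_int_mult)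
    with assms False show False by (metis abs_of_nat dvd_imp_le_int dvd_triv_right not_le)
  qed
  ultimately show ?thesis
    using False unfolding w by (simp add: sum_gp_strict)
qed auto

lemma exp_ii_of_real_eq: "exp (\<i> * of_nat n * of_real t) = cis (real n * t)"
  by (simp add: cis_conv_exp mult.assoc)

lemma T_cis: "T N a t = (\<Sum>n<N. a n * cis (real n * t))"
  by (simp only: T_def exp_ii_of_real_eq)

lemma norm_exp_ii_of_nat_of_real [simp]: "cmod (exp (\<i> * of_nat n * of_real t)) = 1"
  by (simp add: exp_ii_of_real_eq)

text \<open>Frequencies below \<open>N\<close> differ by less than \<open>N\<close>, so
  orthogonality leaves only the diagonal, where the phase caused by the shift \<open>t\<close> is
  1.\<close>

lemma discrete_Parseval:
  "(\<Sum>j<N. (cmod (T N a (t + 2 * pi * real j / real N)))\<^sup>2) = real N * (\<Sum>n<N. (cmod (a n))\<^sup>2)"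
proof -
  define x where "x j = t + 2 * pi * real j / real N" for j
  have "of_real (\<Sum>j<N. (cmod (T N a (x j)))\<^sup>2) = (\<Sum>j<N. T N a (x j) * cnj (T N a (x j)))"
    by (simp only: of_real_sum complex_norm_square)
  also have "\<dots> = (\<Sum>j<N. \<Sum>n<N. \<Sum>m<N. a n * cnj (a m) * (cis (real n * x j) * cis (- (real m * x j))))"
    by (simp add: T_cis sum_product cis_cnj mult_ac)
  also have "\<dots> = (\<Sum>n<N. \<Sum>m<N. a n * cnj (a m) * (\<Sum>j<N. cis (real n * x j) * cis (- (real m * x j))))"
    unfolding sum_distrib_left by (subst sum.swap, rule sum.cong[OF refl], rule sum.swap)
  also have "\<dots> = (\<Sum>n<N. \<Sum>m<N. if m = n then of_nat N * (a n * cnj (a n)) else 0)"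
  proof (intro sum.cong refl)
    fix n m assume nm: "n \<in> {..<N}" "m \<in> {..<N}"
    have "cis (real n * x j) * cis (- (real m * x j)) = cis ((real n - real m) * t) *
       exp (\<i> * of_int (int n - int m) * of_real (2 * pi * real j / real N))" for j
      by (simp add: cis_mult cis_conv_exp x_def algebra_simps diff_divide_distrib flip: exp_add)
    then have "(\<Sum>j<N. cis (real n * x j) * cis (- (real m * x j))) = cis ((real n - real m) * t) *
      (\<Sum>j<N. exp (\<i> * of_int (int n - int m) * of_real (2 * pi * real j / real N)))"
      by (simp add: sum_distrib_left)
    also have "\<dots> = (if m = n then of_nat N else 0)"
      using nm by (subst sum_exp_equispaced) auto
    finally show "a n * cnj (a m) * (\<Sum>j<N. cis (real n * x j) * cis (- (real m * x j))) =
      (if m = n then of_nat N * (a n * cnj (a n)) else 0)" by auto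
  qed
  also have "\<dots> = of_real (real N * (\<Sum>n<N. (cmod (a n))\<^sup>2))"
    by (simp add: sum_distrib_left flip: complex_norm_square)
  finally show ?thesis unfolding x_def of_real_eq_iff .
qed

text \<open>By duality: interpolation is applied to \<open>a\<close> and a vector \<open>b\<close>
  that is extremal for the sampled values \<open>f\<close>. The form then equals \<open>S\<close>,
  the mean of \<open>cmod (f j) powr q\<close>, and so does the mean of
  \<open>cmod (b j) powr p\<close>. Cancelling \<open>S powr (1 / p)\<close> leaves the
  claim.\<close>

lemma discrete_Hausdorff_Young:
  assumes N: "N \<ge> 1" and p: "1 < p" "p \<le> 2"
  defines "q \<equiv> p / (p - 1)"
  shows "(\<Sum>j<N. cmod (T N a (t + 2 * pi * real j / real N)) powr q)
     \<le> real N * (\<Sum>n<N. cmod (a n) powr p) powr (q / p)"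
proof -
  define x where "x j = t + 2 * pi * real j / real N" for j
  define f where "f j = T N a (x j)" for j
  \<comment> \<open>After division by \<open>N\<close> the entries have modulus
    \<open>w = 1 / N\<close>, and sums over \<open>j\<close> become means over the points.\<close>
  define K where "K n j = exp (\<i> * of_nat n * of_real (x j)) / of_nat N" for n j :: nat
  define w where "w = 1 / real N"
  have w: "w > 0" using N by (simp add: w_def)
  have K: "(\<Sum>n<N. \<Sum>j<N. K n j * (c n * b j)) = of_real w * (\<Sum>j<N. T N c (x j) * b j)" for c b
  proof -
    have "(\<Sum>n<N. \<Sum>j<N. K n j * (c n * b j)) = (\<Sum>j<N. \<Sum>n<N. K n j * (c n * b j))"
      by (rule sum.swap)
    then show ?thesis
      by (simp add: K_def T_def w_def sum_distrib_left sum_distrib_right sum_divide_distrib mult_ac)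
  qed
  have q: "q > 1" "(q - 1) * p = q" using p by (simp_all add: q_def field_simps)
  \<comment> \<open>the vector that attains equality in Hoelder's inequality against \<open>f\<close>\<close>
  define b where "b j = cnj (sgn (f j)) * of_real (cmod (f j) powr (q - 1))" for j
  define S where "S = w * (\<Sum>j<N. cmod (f j) powr q)"
  define A where "A = (\<Sum>n<N. cmod (a n) powr p)"
  have fb: "f j * b j = of_real (cmod (f j) powr q)" for j
  proof (cases "f j = 0")
    case False
    have "f j * cnj (sgn (f j)) = of_real (cmod (f j))"
      using False by (simp add: sgn_eq complex_norm_square[symmetric] power2_eq_square)
    then have "f j * b j = of_real (cmod (f j) * cmod (f j) powr (q - 1))"
      by (simp add: b_def flip: mult.assoc)
    also have "cmod (f j) * cmod (f j) powr (q - 1) = cmod (f j) powr q"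
      using False by (simp add: powr_mult_base)
    finally show ?thesis .
  qed simp
  have bp: "cmod (b j) powr p = cmod (f j) powr q" for j
    by (cases "f j = 0") (simp_all add: b_def norm_mult norm_sgn powr_powr q)
  have S0: "S \<ge> 0" using w by (auto simp: S_def sum_nonneg)
  have "cmod (\<Sum>n<N. \<Sum>j<N. K n j * (a n * b j))
    \<le> (\<Sum>n<N. cmod (a n) powr p) powr (1 / p) * (w * (\<Sum>j<N. cmod (b j) powr p)) powr (1 / p)"
  proof (rule bilinear_interpolation)
    fix c d :: "nat \<Rightarrow> complex"
    \<comment> \<open>Cauchy--Schwarz and \<open>discrete_Parseval\<close> give the estimate with
      exponent 2.\<close>
    have "cmod (\<Sum>j<N. T N c (x j) * d j) \<le> (\<Sum>j<N. cmod (T N c (x j)) * cmod (d j))"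
      by (rule order_trans[OF norm_sum]) (simp add: norm_mult)
    also have "\<dots> \<le> sqrt (\<Sum>j<N. (cmod (T N c (x j)))\<^sup>2) * sqrt (\<Sum>j<N. (cmod (d j))\<^sup>2)"
      using L2_set_mult_ineq[of "\<lambda>j. cmod (T N c (x j))" "\<lambda>j. cmod (d j)" "{..<N}"] by (simp add: L2_set_def)
    also have "(\<Sum>j<N. (cmod (T N c (x j)))\<^sup>2) = real N * (\<Sum>n<N. (cmod (c n))\<^sup>2)"
      unfolding x_def by (rule discrete_Parseval)
    finally have "w * cmod (\<Sum>j<N. T N c (x j) * d j)
      \<le> w * (sqrt (real N * (\<Sum>n<N. (cmod (c n))\<^sup>2)) * sqrt (\<Sum>j<N. (cmod (d j))\<^sup>2))"
      using w by (intro mult_left_mono) auto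
    also have "\<dots> = sqrt (\<Sum>n<N. (cmod (c n))\<^sup>2) * sqrt (w * (\<Sum>j<N. (cmod (d j))\<^sup>2))"
      using N by (simp add: w_def real_sqrt_mult real_sqrt_divide field_simps)
    finally show "cmod (\<Sum>n<N. \<Sum>j<N. K n j * (c n * d j))
        \<le> sqrt (\<Sum>n<N. (cmod (c n))\<^sup>2) * sqrt (w * (\<Sum>j<N. (cmod (d j))\<^sup>2))"
      using w by (simp add: K norm_mult)
  qed (use p w in \<open>auto simp: K_def w_def norm_divide\<close>)
  also have "(\<Sum>n<N. \<Sum>j<N. K n j * (a n * b j)) = of_real S"
    by (simp add: K S_def fb flip: f_def)
  finally have "S \<le> A powr (1 / p) * S powr (1 / p)"
    using S0 by (simp add: bp A_def flip: S_def)
  moreover have "S = S powr (1 / q) * S powr (1 / p)"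
  proof -
    have "1 / q + 1 / p = 1" using p by (simp add: q_def field_simps)
    then show ?thesis using S0 by (simp flip: powr_add)
  qed
  ultimately have "S powr (1 / q) \<le> A powr (1 / p)"
    using S0 by (cases "S = 0") (auto intro: mult_right_le_imp_le[where c = "S powr (1 / p)"])
  then have "(S powr (1 / q)) powr q \<le> (A powr (1 / p)) powr q"
    using q by (intro powr_mono2) auto
  then have "S \<le> A powr (q / p)" using q S0 by (simp add: powr_powr)
  then show ?thesis using N unfolding S_def w_def f_def x_def A_def by (simp add: field_simps)
qed

section \<open>Integrals as integrals of equispaced sums\<close>

text \<open>The interval is cut into \<open>N\<close> pieces of length \<open>L\<close>, each
  translated to the first.\<close>

lemma integral_equispaced_shifts:
  fixes h :: "real \<Rightarrow> real"
  assumes "continuous_on UNIV h" and "L \<ge> 0"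
  shows "integral {c..c + real N * L} h = integral {c..c + L} (\<lambda>t. \<Sum>j<N. h (t + real j * L))"
proof -
  have int: "g integrable_on {a..b}" if "continuous_on UNIV g" for g :: "real \<Rightarrow> real" and a b
    using that by (meson continuous_on_subset integrable_continuous_real subset_UNIV)
  have shift: "integral {c + real j * L..c + L + real j * L} h = integral {c..c + L} (\<lambda>t. h (t + real j * L))" for j
    using integral_shift_real_ivl[of "c + real j * L" "real j * L" "c + L + real j * L" h] by simp
  have "integral {c..c + real N * L} h = (\<Sum>j<N. integral {c..c + L} (\<lambda>t. h (t + real j * L)))"
  proof (induction N)
    case (Suc N)
    have "integral {c..c + real (Suc N) * L} h
        = integral {c..c + real N * L} h + integral {c + real N * L..c + real (Suc N) * L} h"
      by (intro Henstock_Kurzweil_Integration.integral_combine[symmetric] int assms(1)) (use assms(2) in \<open>auto simp: algebra_simps\<close>)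
    also have "integral {c + real N * L..c + real (Suc N) * L} h = integral {c..c + L} (\<lambda>t. h (t + real N * L))"
      using shift[of N] by (simp add: algebra_simps)
    finally show ?case using Suc by simp
  qed simp
  also have "\<dots> = integral {c..c + L} (\<lambda>t. \<Sum>j<N. h (t + real j * L))"
  proof (rule integral_sum[symmetric])
    fix j
    show "(\<lambda>t. h (t + real j * L)) integrable_on {c..c + L}"
      by (intro int continuous_on_compose2[OF assms(1)] continuous_intros) auto
  qed simp
  finally show ?thesis .
qed

section \<open>Basic properties of the norms\<close>

lemma exponent_cases:
  assumes "(1::ereal) \<le> p"
  obtains "p = \<infinity>" "recip p = 0" | r where "p = ereal r" "1 \<le> r" "recip p = 1 / r"
  using assms by (cases p) (auto simp: recip_ereal)

lemma fun_norm_real: "0 < q \<Longrightarrow> fun_norm (ereal q) f = (1 / (2 * pi) * integral {-pi..pi} (\<lambda>t. cmod (f t) powr q)) powr (1 / q)"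
  by (simp add: fun_norm_def recip_ereal)

lemma seq_norm_real: "0 < p \<Longrightarrow> seq_norm N (ereal p) a = (\<Sum>n<N. cmod (a n) powr p) powr (1 / p)"
  by (simp add: seq_norm_def recip_ereal)

lemma continuous_on_T [continuous_intros]: "continuous_on S (T N a)"
  unfolding T_def by (intro continuous_intros)

lemma continuous_on_cmod_powr:
  fixes f :: "real \<Rightarrow> complex"
  assumes "continuous_on S f" "0 < q"
  shows "continuous_on S (\<lambda>t. cmod (f t) powr q)"
  using assms by (intro continuous_on_powr' continuous_intros) auto

lemma integrable_cmod_powr:
  fixes f :: "real \<Rightarrow> complex"
  assumes "continuous_on {a..b} f" "0 < q"
  shows "(\<lambda>t. cmod (f t) powr q) integrable_on {a..b}"
  by (intro integrable_continuous_real continuous_on_cmod_powr assms)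

lemma fun_norm_leI:
  assumes "0 < q" "0 \<le> A" and int: "integral {-pi..pi} (\<lambda>t. cmod (f t) powr q) \<le> 2 * pi * A powr q"
  shows "fun_norm (ereal q) f \<le> A"
proof -
  have "fun_norm (ereal q) f \<le> (A powr q) powr (1 / q)"
    unfolding fun_norm_real[OF assms(1)]
  proof (rule powr_mono2)
    show "0 \<le> 1 / (2 * pi) * integral {-pi..pi} (\<lambda>t. cmod (f t) powr q)"
      using Henstock_Kurzweil_Integration.integral_nonneg[of "\<lambda>t. cmod (f t) powr q" "{-pi..pi}"]
      \<comment> \<open>The \<open>integral\<close> of a non-integrable function is 0 by definition,
        so nonnegativity holds in that case too.\<close>
      by (cases "(\<lambda>t. cmod (f t) powr q) integrable_on {-pi..pi}") (auto simp: not_integrable_integral)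
    show "1 / (2 * pi) * integral {-pi..pi} (\<lambda>t. cmod (f t) powr q) \<le> A powr q"
      using int by (simp add: field_simps)
  qed (use assms in auto)
  then show ?thesis using assms by (simp add: powr_powr)
qed

lemma fun_norm_geI:
  assumes "0 < q" "0 \<le> A" and int: "2 * pi * A powr q \<le> integral {-pi..pi} (\<lambda>t. cmod (f t) powr q)"
  shows "A \<le> fun_norm (ereal q) f"
proof -
  have "(A powr q) powr (1 / q) \<le> fun_norm (ereal q) f"
    unfolding fun_norm_real[OF assms(1)] using assms by (intro powr_mono2) (auto simp: field_simps)
  then show ?thesis using assms by (simp add: powr_powr)
qed

text \<open>Compactness bounds the set of values; on an unbounded set the real \<open>SUP\<close>
  would be unspecified.\<close>

lemma cmod_le_fun_norm_infinity:
  assumes "continuous_on {-pi..pi} f" "t \<in> {-pi..pi}"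
  shows "cmod (f t) \<le> fun_norm \<infinity> f"
proof -
  have "compact ((\<lambda>t. cmod (f t)) ` {-pi..pi})"
    by (intro compact_continuous_image continuous_intros assms) auto
  then have "bdd_above ((\<lambda>t. cmod (f t)) ` {-pi..pi})"
    by (intro bounded_imp_bdd_above compact_imp_bounded)
  then show ?thesis using assms by (auto simp: fun_norm_def intro: cSUP_upper)
qed

lemma fun_norm_nonneg:
  assumes "continuous_on {-pi..pi} f"
  shows "0 \<le> fun_norm q f"
proof (cases "q = \<infinity>")
  case True
  have "cmod (f 0) \<le> fun_norm \<infinity> f" using assms by (intro cmod_le_fun_norm_infinity) auto
  then show ?thesis using True norm_ge_zero order_trans by blast
qed (simp add: fun_norm_def)

section \<open>Parseval and Hausdorff--Young on the circle\<close>

text \<open>For \<open>L = 2 * pi / N\<close> the shifts are the sampling points of the discrete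
  inequalities, which can thus be integrated over one short interval.\<close>

lemma integral_eq_equispaced_average:
  fixes h :: "real \<Rightarrow> real"
  assumes "continuous_on UNIV h" "N \<ge> 1"
  shows "integral {-pi..pi} h = integral {-pi..-pi + 2 * pi / real N} (\<lambda>t. \<Sum>j<N. h (t + 2 * pi * real j / real N))"
  using integral_equispaced_shifts[OF assms(1), of "2 * pi / real N" "- pi" N] assms(2)
  by (simp add: mult_ac)

lemma Parseval:
  assumes "N \<ge> 1"
  shows "integral {-pi..pi} (\<lambda>t. (cmod (T N a t))\<^sup>2) = 2 * pi * (\<Sum>n<N. (cmod (a n))\<^sup>2)"
proof -
  have "integral {-pi..pi} (\<lambda>t. (cmod (T N a t))\<^sup>2) =
      integral {-pi..-pi + 2 * pi / real N} (\<lambda>t. real N * (\<Sum>n<N. (cmod (a n))\<^sup>2))"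
    using integral_eq_equispaced_average[of "\<lambda>t. (cmod (T N a t))\<^sup>2" N] assms
    by (simp add: discrete_Parseval continuous_intros)
  then show ?thesis using assms by simp
qed

text \<open>The discrete inequality holds for every \<open>t\<close>. Integrated over an interval of
  length \<open>2 * pi / N\<close>, its factor \<open>real N\<close> becomes
  \<open>2 * pi\<close>.\<close>

lemma Hausdorff_Young:
  assumes N: "N \<ge> 1" and p: "1 < p" "p \<le> 2"
  shows "fun_norm (ereal (p / (p - 1))) (T N a) \<le> seq_norm N (ereal p) a"
proof (rule fun_norm_leI)
  define q where "q = p / (p - 1)"
  have q: "q > 0" using p by (simp add: q_def)
  show "0 < p / (p - 1)" using p by simp
  show "0 \<le> seq_norm N (ereal p) a" by (simp add: seq_norm_def)
  define h where "h t = cmod (T N a t) powr q" for t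
  have h: "continuous_on S h" for S unfolding h_def
    by (intro continuous_on_cmod_powr continuous_intros q)
  have "integral {-pi..pi} h =
      integral {-pi..-pi + 2 * pi / real N} (\<lambda>t. \<Sum>j<N. h (t + 2 * pi * real j / real N))"
    by (rule integral_eq_equispaced_average[OF h N])
  also have "\<dots> \<le> integral {-pi..-pi + 2 * pi / real N} (\<lambda>t. real N * (\<Sum>n<N. cmod (a n) powr p) powr (q / p))"
  proof (rule integral_le)
    show "(\<lambda>t. \<Sum>j<N. h (t + 2 * pi * real j / real N)) integrable_on {- pi..- pi + 2 * pi / real N}"
      by (intro integrable_continuous_real continuous_intros continuous_on_compose2[OF h]) auto
  qed (use discrete_Hausdorff_Young[OF N p] in \<open>auto simp: h_def q_def\<close>)
  also have "\<dots> = 2 * pi * seq_norm N (ereal p) a powr q"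
    using N p by (simp add: seq_norm_real powr_powr)
  finally show "integral {-pi..pi} (\<lambda>t. cmod (T N a t) powr (p / (p - 1)))
     \<le> 2 * pi * seq_norm N (ereal p) a powr (p / (p - 1))"
    unfolding h_def[abs_def] q_def .
qed

text \<open>The conjugate exponent of 1 is infinite and not given by \<open>p / (p - 1)\<close>; the
  triangle inequality takes over.\<close>

lemma Hausdorff_Young_endpoint: "fun_norm \<infinity> (T N a) \<le> seq_norm N 1 a"
proof -
  have "cmod (T N a t) \<le> (\<Sum>n<N. cmod (a n))" for t
    unfolding T_def by (rule order_trans[OF norm_sum]) (simp add: norm_mult)
  then have "fun_norm \<infinity> (T N a) \<le> (\<Sum>n<N. cmod (a n))"
    by (auto simp: fun_norm_def intro!: cSUP_least)
  also have "\<dots> = seq_norm N 1 a"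
    by (simp add: seq_norm_real one_ereal_def sum_nonneg)
  finally show ?thesis .
qed

section \<open>Power means and monotonicity of the norms\<close>

text \<open>The concave function \<open>y powr (q / r)\<close> lies below its tangent at 1, here
  evaluated at \<open>y = (x / A) powr r\<close>. If the mean of \<open>x powr r\<close> is at most
  \<open>A powr r\<close>, the mean of the bracket is at most 1; this yields the power mean
  inequality for integrals and for sums alike.\<close>

lemma powr_le_tangent:
  fixes x A q r :: real
  assumes "0 \<le> x" "0 < A" "0 < q" "q \<le> r"
  shows "x powr q \<le> A powr q * (q / r * (x powr r / A powr r) + (1 - q / r))"
proof (cases "x = 0")
  case False
  have "((x / A) powr r) powr (q / r) * 1 powr (1 - q / r) \<le> q / r * (x / A) powr r + (1 - q / r) * 1"
    using assms False by (intro Youngs_inequality_0) auto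
  then show ?thesis using assms False by (simp add: powr_powr powr_divide field_simps)
qed (use assms in auto)

lemma power_mean_integral:
  assumes f: "continuous_on {-pi..pi} f" and qr: "0 < q" "q \<le> r" and A: "0 < A"
    and int: "integral {-pi..pi} (\<lambda>t. cmod (f t) powr r) \<le> 2 * pi * A powr r"
  shows "integral {-pi..pi} (\<lambda>t. cmod (f t) powr q) \<le> 2 * pi * A powr q"
proof -
  have i: "(\<lambda>t. cmod (f t) powr s) integrable_on {-pi..pi}" if "s > 0" for s
    using integrable_cmod_powr[OF f that] .
  have hi: "((\<lambda>t. A powr q * (q / r * (cmod (f t) powr r / A powr r) + (1 - q / r))) has_integral
     A powr q * (q / r * (integral {-pi..pi} (\<lambda>t. cmod (f t) powr r) / A powr r) + (1 - q / r) * (2 * pi))) {-pi..pi}"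
    using has_integral_const_real[of "1 - q / r" "-pi" pi] i[of r] qr
    by (intro has_integral_mult_right has_integral_add has_integral_divide integrable_integral) (auto simp: mult_ac)
  have "integral {-pi..pi} (\<lambda>t. cmod (f t) powr q)
     \<le> A powr q * (q / r * (integral {-pi..pi} (\<lambda>t. cmod (f t) powr r) / A powr r) + (1 - q / r) * (2 * pi))"
    using powr_le_tangent A qr
    by (intro has_integral_le[OF integrable_integral hi] i) auto
  also have "\<dots> \<le> A powr q * (q / r * (2 * pi) + (1 - q / r) * (2 * pi))"
    using int A qr by (intro mult_left_mono add_mono) (auto simp: field_simps)
  also have "\<dots> = 2 * pi * A powr q" by (simp add: algebra_simps)
  finally show ?thesis .
qed

lemma fun_norm_mono:
  assumes f: "continuous_on {-pi..pi} f" and qr: "1 \<le> q" "q \<le> r"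
  shows "fun_norm q f \<le> fun_norm r f"
proof (cases "q = \<infinity>")
  case False
  then obtain q' where q: "q = ereal q'" "1 \<le> q'" using exponent_cases[OF qr(1)] by metis
  have "1 \<le> r" using qr by (rule order_trans)
  then show ?thesis
  proof (cases rule: exponent_cases)
    case 1
    have "integral {-pi..pi} (\<lambda>t. cmod (f t) powr q') \<le> integral {-pi..pi} (\<lambda>t. fun_norm \<infinity> f powr q')"
      using q cmod_le_fun_norm_infinity[OF f]
      by (intro integral_le integrable_cmod_powr f powr_mono2) auto
    then show ?thesis
      using q fun_norm_nonneg[OF f] unfolding 1 q(1) by (intro fun_norm_leI) auto
  next
    case (2 r')
    have qr': "q' \<le> r'" "0 < q'" using qr 2 q by auto
    show ?thesis
    proof (rule field_le_epsilon)
      fix \<epsilon> :: real assume "\<epsilon> > 0"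
      \<comment> \<open>The tangent bound requires a positive \<open>A\<close>, while the norm
        itself may be 0.\<close>
      define A where "A = fun_norm r f + \<epsilon>"
      have A: "A > 0" using fun_norm_nonneg[OF f, of r] \<open>\<epsilon> > 0\<close> by (simp add: A_def)
      have "1 / (2 * pi) * integral {-pi..pi} (\<lambda>t. cmod (f t) powr r') = fun_norm r f powr r'"
        using Henstock_Kurzweil_Integration.integral_nonneg[OF integrable_cmod_powr[OF f, of r']] 2(2)
        by (simp add: 2(1) fun_norm_real powr_powr)
      also have "\<dots> \<le> A powr r'"
        using fun_norm_nonneg[OF f, of r] \<open>\<epsilon> > 0\<close> 2 by (intro powr_mono2) (auto simp: A_def)
      finally have "integral {-pi..pi} (\<lambda>t. cmod (f t) powr r') \<le> 2 * pi * A powr r'"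
        by (simp add: field_simps)
      then have "integral {-pi..pi} (\<lambda>t. cmod (f t) powr q') \<le> 2 * pi * A powr q'"
        using power_mean_integral[OF f _ qr'(1) A] qr' by simp
      then show "fun_norm q f \<le> fun_norm r f + \<epsilon>"
        unfolding q(1) A_def[symmetric] using A qr' by (intro fun_norm_leI) auto
    qed
  qed
qed (use qr in auto)

lemma seq_norm_pos:
  assumes "n < N" "a n \<noteq> 0"
  shows "0 < seq_norm N p a"
proof (cases "p = \<infinity>")
  case True
  have "cmod (a n) \<le> Max ((\<lambda>n. cmod (a n)) ` {..<N})" using assms by (intro Max_ge) auto
  moreover have "0 < cmod (a n)" using assms by simp
  ultimately have "0 < Max ((\<lambda>n. cmod (a n)) ` {..<N})" by linarith
  with True show ?thesis by (simp add: seq_norm_def)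
next
  case False
  have "0 < (\<Sum>n<N. cmod (a n) powr real_of_ereal p)"
    by (rule sum_pos2[of _ n]) (use assms in auto)
  with False show ?thesis by (simp add: seq_norm_def)
qed

lemma power_mean_sum:
  assumes sp: "0 < s" "s \<le> p" and A: "0 < A"
    and "(\<Sum>n<N. cmod (a n) powr p) \<le> real N * A powr p"
  shows "(\<Sum>n<N. cmod (a n) powr s) \<le> real N * A powr s"
proof -
  have "(\<Sum>n<N. cmod (a n) powr s) \<le> (\<Sum>n<N. A powr s * (s / p * (cmod (a n) powr p / A powr p) + (1 - s / p)))"
    using sp A by (intro sum_mono powr_le_tangent) auto
  also have "\<dots> = A powr s * (s / p * ((\<Sum>n<N. cmod (a n) powr p) / A powr p) + real N * (1 - s / p))"
    by (simp add: sum.distrib sum_subtractf sum_distrib_left sum_divide_distrib algebra_simps)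
  also have "\<dots> \<le> A powr s * (s / p * real N + real N * (1 - s / p))"
    using assms by (intro mult_left_mono add_mono) (auto simp: field_simps)
  also have "\<dots> = real N * A powr s" by (simp add: algebra_simps)
  finally show ?thesis .
qed

text \<open>Power means of the \<open>N\<close> moduli increase with the exponent; the power of
  \<open>N\<close> appears because \<open>seq_norm\<close> uses a sum and not a mean.\<close>

lemma seq_norm_mono:
  assumes a: "\<exists>n<N. a n \<noteq> 0" and s: "1 \<le> s" and sp: "ereal s \<le> p"
  shows "seq_norm N (ereal s) a \<le> real N powr (1 / s - recip p) * seq_norm N p a"
proof -
  have N: "N > 0" using a by auto
  have pos: "0 < seq_norm N p a" using a seq_norm_pos by blast
  have "1 \<le> ereal s" using s by (simp add: one_ereal_def)
  then have "1 \<le> p" using sp by (rule order_trans)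
  \<comment> \<open>The power mean of order \<open>p\<close>; for \<open>p = \<infinity>\<close> it
    is the maximum, as \<open>recip p\<close> is then 0.\<close>
  define A where "A = real N powr (- recip p) * seq_norm N p a"
  have A: "A > 0" using pos N by (simp add: A_def)
  have "(\<Sum>n<N. cmod (a n) powr s) \<le> real N * A powr s"
    using \<open>1 \<le> p\<close>
  proof (cases rule: exponent_cases)
    case 1
    have "(\<Sum>n<N. cmod (a n) powr s) \<le> (\<Sum>n<N. A powr s)"
      using s 1 N by (intro sum_mono powr_mono2) (auto simp: A_def seq_norm_def)
    then show ?thesis by simp
  next
    case (2 r)
    have "real N * A powr r = (\<Sum>n<N. cmod (a n) powr r)"
    proof -
      have "(real N powr - (1 / r)) powr r = 1 / real N"
        using 2 N by (subst powr_powr) (simp add: powr_minus_divide)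
      moreover have "((\<Sum>n<N. cmod (a n) powr r) powr (1 / r)) powr r = (\<Sum>n<N. cmod (a n) powr r)"
        using 2 by (subst powr_powr) (simp add: sum_nonneg)
      ultimately show ?thesis
        using 2 N by (simp add: A_def powr_mult seq_norm_real)
    qed
    then show ?thesis
      using power_mean_sum[where N = N and a = a, OF _ _ A, of s r] s sp 2 by auto
  qed
  then have "seq_norm N (ereal s) a \<le> (real N * A powr s) powr (1 / s)"
    using s by (auto simp: seq_norm_real sum_nonneg intro!: powr_mono2)
  also have "\<dots> = real N powr (1 / s) * A"
    using s A by (simp add: powr_mult powr_powr)
  also have "\<dots> = real N powr (1 / s - recip p) * seq_norm N p a"
    by (simp add: A_def powr_add[symmetric] flip: mult.assoc)
  finally show ?thesis .
qed

lemma recip_nonneg: "1 \<le> p \<Longrightarrow> 0 \<le> recip p"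
  by (erule exponent_cases) auto

section \<open>Reduction to norm inequalities, and the upper bounds\<close>

lemma C_leI:
  assumes "\<And>a. \<exists>n<N. a n \<noteq> 0 \<Longrightarrow> fun_norm q (T N a) \<le> K * seq_norm N p a"
  shows "C N p q \<le> ereal K"
  unfolding C_def
proof (rule SUP_least)
  fix a assume "a \<in> {a :: nat \<Rightarrow> complex. \<exists>n<N. a n \<noteq> 0}"
  then have a: "\<exists>n<N. a n \<noteq> 0" by simp
  then have "0 < seq_norm N p a" using seq_norm_pos by blast
  then show "ereal (fun_norm q (T N a) / seq_norm N p a) \<le> ereal K"
    using assms[OF a] by (simp add: pos_divide_le_eq)
qed

lemma C_geI:
  assumes "n < N" "a n \<noteq> 0" "K * seq_norm N p a \<le> fun_norm q (T N a)"
  shows "ereal K \<le> C N p q"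
proof -
  have "ereal K \<le> ereal (fun_norm q (T N a) / seq_norm N p a)"
    using assms seq_norm_pos[of n N a p] by (simp add: le_divide_eq)
  also have "\<dots> \<le> C N p q" unfolding C_def using assms by (intro SUP_upper) auto
  finally show ?thesis .
qed

text \<open>Conjugacy expressed by reciprocals also covers the pair of 1 and
  \<open>\<infinity>\<close>.\<close>

lemma Hausdorff_Young_ereal:
  assumes N: "N \<ge> 1" and p: "1 \<le> p" "p \<le> 2" and q: "1 \<le> q" "recip q = 1 - 1 / p"
  shows "fun_norm q (T N a) \<le> seq_norm N (ereal p) a"
  using q(1)
proof (cases rule: exponent_cases)
  case 1
  then have "p = 1" using q p by simp
  then show ?thesis using Hausdorff_Young_endpoint 1 by (simp add: one_ereal_def)
next
  case (2 r)
  then have p1: "p > 1" using p q by (cases "p = 1") auto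
  have "1 / r = 1 - 1 / p" using 2 q by simp
  then have "r = p / (p - 1)" using 2 p1 by (simp add: field_simps)
  then show ?thesis using Hausdorff_Young[OF N p1 p(2)] 2 by simp
qed

text \<open>From \<open>q\<close> up to \<open>q'\<close>, by Hausdorff--Young to the conjugate
  exponent \<open>s\<close>, then from \<open>s\<close> up to \<open>p\<close>: only the last step
  costs a power of \<open>N\<close>.\<close>

lemma C_upper_bound:
  assumes N: "N \<ge> 1" and p: "1 \<le> p" and q: "1 \<le> q" "q \<le> q'"
    and s: "1 \<le> s" "s \<le> 2" "ereal s \<le> p" and q': "recip q' = 1 - 1 / s"
  shows "C N p q \<le> ereal (real N powr (1 / s - recip p))"
proof (rule C_leI)
  fix a :: "nat \<Rightarrow> complex" assume a: "\<exists>n<N. a n \<noteq> 0"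
  have "fun_norm q (T N a) \<le> fun_norm q' (T N a)"
    by (intro fun_norm_mono q continuous_intros)
  also have "\<dots> \<le> seq_norm N (ereal s) a"
    using q by (intro Hausdorff_Young_ereal N s q') auto
  also have "\<dots> \<le> real N powr (1 / s - recip p) * seq_norm N p a"
    by (intro seq_norm_mono a s)
  finally show "fun_norm q (T N a) \<le> real N powr (1 / s - recip p) * seq_norm N p a" .
qed

lemma recip_le_imp_ge:
  assumes "1 \<le> p" "1 \<le> q" "recip p \<le> recip q"
  shows "q \<le> p"
  using assms(1)
proof (cases rule: exponent_cases)
  case (2 r)
  then have r: "1 / r \<le> recip q" "1 / r > 0" using assms by auto
  from assms(2) show ?thesis
  proof (cases rule: exponent_cases)
    case (2 r')
    then have "1 / r \<le> 1 / r'" using r by simp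
    then show ?thesis using 2 \<open>p = ereal r\<close> \<open>1 \<le> r\<close> by (simp add: field_simps)
  qed (use r in simp)
qed simp

lemma ex_recip:
  assumes "0 \<le> x" "x \<le> 1"
  obtains q where "1 \<le> q" "recip q = x"
proof (cases "x = 0")
  case True
  then show ?thesis using that[of \<infinity>] by simp
next
  case False
  then show ?thesis using that[of "ereal (1 / x)"] assms
    by (simp add: recip_ereal one_ereal_def field_simps)
qed

text \<open>Here \<open>x\<close> is the reciprocal of the intermediate exponent. The upper bounds
  in the three regions are the instances \<open>x = recip p\<close>, \<open>x = 1 - recip q\<close>
  and \<open>x = 1 / 2\<close>.\<close>

lemma C_upper_bound_recip:
  assumes N: "N \<ge> 1" and p: "1 \<le> p" and q: "1 \<le> q"
    and x: "1 / 2 \<le> x" "x \<le> 1" "recip p \<le> x" "1 - x \<le> recip q"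
  shows "C N p q \<le> ereal (real N powr (x - recip p))"
proof -
  have x01: "0 \<le> 1 - x" "1 - x \<le> 1" using x by linarith+
  obtain q' where q': "1 \<le> q'" "recip q' = 1 - x" by (rule ex_recip[OF x01])
  have x0: "0 < x" using x by linarith
  have s: "1 \<le> 1 / x" "1 / x \<le> 2"
    using x by (simp_all add: pos_le_divide_eq[OF x0] pos_divide_le_eq[OF x0])
  have "1 \<le> ereal (1 / x)" using s by (simp add: one_ereal_def)
  moreover have "recip p \<le> recip (ereal (1 / x))" using x(3) x0 by (simp add: recip_ereal)
  ultimately have sp: "ereal (1 / x) \<le> p" by (rule recip_le_imp_ge[OF p])
  have "recip q' \<le> recip q" unfolding q' by (rule x)
  then have qq': "q \<le> q'" by (rule recip_le_imp_ge[OF q'(1) q])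
  have "C N p q \<le> ereal (real N powr (1 / (1 / x) - recip p))"
    by (rule C_upper_bound[OF N p q qq' s sp]) (simp add: q')
  then show ?thesis by (simp only: div_by_1 divide_divide_eq_right mult_1)
qed

section \<open>Test vectors and the lower bounds\<close>

text \<open>Evaluates the norms of all three test vectors; the trailing zeros allow for a single
  coefficient and for lengths that are powers of two.\<close>

lemma seq_norm_unimodular:
  assumes M: "1 \<le> M" "M \<le> N" and p: "1 \<le> p"
    and a: "\<And>n. n < M \<Longrightarrow> cmod (a n) = 1" "\<And>n. M \<le> n \<Longrightarrow> a n = 0"
  shows "seq_norm N p a = real M powr recip p"
  using p
proof (cases rule: exponent_cases)
  case 1
  have "Max ((\<lambda>n. cmod (a n)) ` {..<N}) = 1"
  proof (rule Max_eqI)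
    show "1 \<in> (\<lambda>n. cmod (a n)) ` {..<N}" using M a(1)[of 0] by force
    fix y assume "y \<in> (\<lambda>n. cmod (a n)) ` {..<N}"
    then obtain n where "y = cmod (a n)" by blast
    then show "y \<le> 1" using a by (cases "n < M") auto
  qed simp
  then show ?thesis using 1 M by (simp add: seq_norm_def)
next
  case (2 r)
  have "(\<Sum>n<N. cmod (a n) powr r) = (\<Sum>n<M. cmod (a n) powr r)"
    using M a by (intro sum.mono_neutral_right) auto
  also have "\<dots> = real M" using a by simp
  finally show ?thesis using 2 by (simp add: seq_norm_real)
qed

lemma one_le_C:
  assumes N: "N \<ge> 1" and p: "1 \<le> p" and q: "1 \<le> q"
  shows "1 \<le> C N p q"
proof -
  define a :: "nat \<Rightarrow> complex" where "a n = (if n = 0 then 1 else 0)" for n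
  have T: "T N a t = 1" for t
    using N by (simp add: T_def a_def if_distrib[of "\<lambda>x. x * _"] cong: if_cong)
  have "fun_norm q (T N a) = 1"
    using q by (cases rule: exponent_cases) (auto simp: T fun_norm_real fun_norm_def)
  moreover have "seq_norm N p a = 1"
    using seq_norm_unimodular[of 1 N p a] N p by (simp add: a_def)
  ultimately have "ereal 1 \<le> C N p q"
    using N by (intro C_geI[of 0 N a]) (auto simp: a_def)
  then show ?thesis by (simp add: one_ereal_def)
qed

text \<open>On \<open>[0, 1/N]\<close> all phases of the Dirichlet kernel are at most 1, hence below
  \<open>pi / 3\<close>, so the real parts add up to at least \<open>N / 2\<close>. The length of
  this interval accounts for \<open>N powr (- recip q)\<close>.\<close>

lemma C_lower_bound_Dirichlet:
  assumes N: "N \<ge> 1" and p: "1 \<le> p" and q: "1 \<le> q"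
  shows "ereal (1 / (4 * pi) * real N powr (1 - recip q - recip p)) \<le> C N p q"
proof -
  define a :: "nat \<Rightarrow> complex" where "a n = (if n < N then 1 else 0)" for n
  have T_ge: "real N / 2 \<le> cmod (T N a t)" if t: "0 \<le> t" "t \<le> 1 / real N" for t
  proof -
    have "1 / 2 \<le> cos (real n * t)" if "n < N" for n
    proof -
      have "real n * t \<le> real N * (1 / real N)" using t that by (intro mult_mono) auto
      then have "real n * t \<le> pi / 3" using N pi_gt3 by simp
      then have "cos (pi / 3) \<le> cos (real n * t)" using t by (intro cos_monotone_0_pi_le) auto
      then show ?thesis by (simp add: cos_60)
    qed
    then have "(\<Sum>n<N. 1 / 2) \<le> (\<Sum>n<N. cos (real n * t))" by (intro sum_mono) auto
    also have "\<dots> = Re (T N a t)" by (simp add: T_cis a_def)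
    also have "\<dots> \<le> cmod (T N a t)" by (rule complex_Re_le_cmod)
    finally show ?thesis by simp
  qed
  have "1 / (4 * pi) * real N powr (1 - recip q) \<le> fun_norm q (T N a)"
    using q
  proof (cases rule: exponent_cases)
    case 1
    have "1 / (4 * pi) * real N \<le> 1 / 2 * real N"
      using pi_gt3 by (intro mult_right_mono) (auto simp: field_simps)
    also have "\<dots> \<le> cmod (T N a 0)" using T_ge[of 0] by simp
    also have "\<dots> \<le> fun_norm q (T N a)"
      unfolding 1 by (intro cmod_le_fun_norm_infinity continuous_intros) auto
    finally show ?thesis using 1 N by simp
  next
    case (2 r)
    \<comment> \<open>The norm of the function equal to \<open>N / 2\<close> on
      \<open>[0, 1/N]\<close> and to 0 elsewhere.\<close>
    define A where "A = (1 / (2 * pi * real N)) powr (1 / r) * (real N / 2)"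
    have int: "(\<lambda>t. cmod (T N a t) powr r) integrable_on {u..v}" for u v
      using 2 by (intro integrable_cmod_powr continuous_intros) auto
    have "2 * pi * A powr r = 1 / real N * (real N / 2) powr r"
    proof -
      have "(x powr (1 / r) * y) powr r = x * y powr r" if "x \<ge> 0" "y \<ge> 0" for x y
        using that 2 by (simp add: powr_mult powr_powr)
      from this[of "1 / (2 * pi * real N)" "real N / 2"] show ?thesis
        using N by (simp add: A_def)
    qed
    also have "\<dots> = integral {0..1 / real N} (\<lambda>t. (real N / 2) powr r)" by simp
    also have "\<dots> \<le> integral {0..1 / real N} (\<lambda>t. cmod (T N a t) powr r)"
      using 2 T_ge by (intro integral_le int powr_mono2) auto
    also have "\<dots> \<le> integral {-pi..pi} (\<lambda>t. cmod (T N a t) powr r)"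
    proof (intro integral_subset_le int)
      have "1 / real N \<le> 1" using N by simp
      then show "{0..1 / real N} \<subseteq> {-pi..pi}" using pi_gt3 by auto
    qed auto
    finally have A: "A \<le> fun_norm q (T N a)"
      unfolding 2 using 2 by (intro fun_norm_geI) (auto simp: A_def)
    \<comment> \<open>Powers of a base below 1 decrease in the exponent, and
      \<open>1 / r \<le> 1\<close>; this makes the constant independent of \<open>r\<close>.\<close>
    have "1 / (2 * pi) \<le> (1 / (2 * pi)) powr (1 / r)"
      using powr_mono'[of "1 / r" 1 "1 / (2 * pi)"] 2 pi_gt3 by auto
    then have "1 / (4 * pi) * real N powr (1 - 1 / r) \<le> (1 / (2 * pi)) powr (1 / r) * real N powr (1 - 1 / r) / 2"
      using mult_right_mono[of "1 / (2 * pi)" "(1 / (2 * pi)) powr (1 / r)" "real N powr (1 - 1 / r)"] by simp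
    also have "\<dots> = A"
    proof -
      have "real N powr (1 - 1 / r) = (1 / real N) powr (1 / r) * real N"
        using N by (simp add: powr_diff powr_divide)
      moreover have "(1 / (2 * pi * real N)) powr (1 / r) = (1 / (2 * pi)) powr (1 / r) * (1 / real N) powr (1 / r)"
        by (simp flip: powr_mult)
      ultimately show ?thesis by (simp only: A_def mult.assoc times_divide_eq_right)
    qed
    finally show ?thesis using A 2 by (simp only:)
  qed
  moreover have "seq_norm N p a = real N powr recip p"
    using N p by (intro seq_norm_unimodular) (auto simp: a_def)
  ultimately have "1 / (4 * pi) * real N powr (1 - recip q - recip p) * seq_norm N p a \<le> fun_norm q (T N a)"
    using N by (simp add: mult.assoc flip: powr_add)
  moreover have "0 < N" "a 0 \<noteq> 0" using N by (auto simp: a_def)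
  ultimately show ?thesis by (intro C_geI[of 0 N a])
qed

lemma sum_lessThan_add:
  fixes f :: "nat \<Rightarrow> 'a::comm_monoid_add"
  shows "(\<Sum>n<M + K. f n) = (\<Sum>n<M. f n) + (\<Sum>n<K. f (M + n))"
  by (induction K) (simp_all add: add.assoc)

text \<open>The recursion sends \<open>(P, Q)\<close> to
  \<open>(P + z ^ M * Q, P - z ^ M * Q)\<close> with \<open>z = cis t\<close>. The two blocks of
  coefficients do not overlap, so all remain unimodular, and the parallelogram law doubles the sum
  of squares.\<close>

lemma Rudin_Shapiro:
  "\<exists>a b. (\<forall>n<2 ^ k. cmod (a n) = 1 \<and> cmod (b n) = 1) \<and> (\<forall>n\<ge>2 ^ k. a n = 0 \<and> b n = 0) \<and>
     (\<forall>t. (cmod (T (2 ^ k) a t))\<^sup>2 + (cmod (T (2 ^ k) b t))\<^sup>2 = 2 * 2 ^ k)"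
proof (induction k)
  case 0
  show ?case
    by (rule exI[of _ "\<lambda>n. if n = 0 then 1 else 0"], rule exI[of _ "\<lambda>n. if n = 0 then 1 else 0"])
       (simp add: T_def)
next
  case (Suc k)
  define M :: nat where "M = 2 ^ k"
  from Suc obtain a b where
    ab: "\<And>n. n < M \<Longrightarrow> cmod (a n) = 1" "\<And>n. n < M \<Longrightarrow> cmod (b n) = 1"
    and ab0: "\<And>n. M \<le> n \<Longrightarrow> a n = 0" "\<And>n. M \<le> n \<Longrightarrow> b n = 0"
    and sq: "\<And>t. (cmod (T M a t))\<^sup>2 + (cmod (T M b t))\<^sup>2 = 2 * real M"
    unfolding M_def by auto
  \<comment> \<open>The coefficients of \<open>P + s * z ^ M * Q\<close>, used for
    \<open>s = 1\<close> and \<open>s = - 1\<close>.\<close>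
  define g where "g s n = (if n < M then a n else s * b (n - M))" for s :: complex and n
  have g: "cmod (g s n) = 1" if "cmod s = 1" "n < M + M" for s n
    using that ab by (auto simp: g_def norm_mult)
  have g0: "g s n = 0" if "M + M \<le> n" for s n
    using that ab0 by (auto simp: g_def)
  have T_g: "T (M + M) (g s) t = T M a t + s * cis (real M * t) * T M b t" for s t
  proof -
    have "T (M + M) (g s) t = (\<Sum>n<M. g s n * cis (real n * t)) + (\<Sum>n<M. g s (M + n) * cis (real (M + n) * t))"
      unfolding T_cis by (rule sum_lessThan_add)
    also have "(\<Sum>n<M. g s n * cis (real n * t)) = T M a t"
      by (simp add: T_cis g_def)
    also have "(\<Sum>n<M. g s (M + n) * cis (real (M + n) * t)) = s * cis (real M * t) * T M b t"
      by (simp add: T_cis g_def sum_distrib_left ring_distribs flip: cis_mult) (simp add: mult_ac)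
    finally show ?thesis .
  qed
  have parallelogram: "(cmod (x + y))\<^sup>2 + (cmod (x - y))\<^sup>2 = 2 * ((cmod x)\<^sup>2 + (cmod y)\<^sup>2)" for x y
    by (simp add: cmod_power2 power2_sum power2_diff)
  have sq_g: "(cmod (T (M + M) (g 1) t))\<^sup>2 + (cmod (T (M + M) (g (- 1)) t))\<^sup>2 = 2 * (real M + real M)" for t
    using parallelogram[of "T M a t" "cis (real M * t) * T M b t"] sq[of t]
    by (simp add: T_g norm_mult)
  have dbl: "2 ^ Suc k = M + M" "(2 :: real) ^ Suc k = real M + real M" by (simp_all add: M_def)
  show ?case
    unfolding dbl
    by (rule exI[of _ "g 1"], rule exI[of _ "g (- 1)"]) (simp add: g g0 sq_g)
qed

text \<open>Since \<open>cmod (T M a t)\<close> never exceeds \<open>sqrt (2 * M)\<close>, its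
  square is at most \<open>sqrt (2 * M)\<close> times itself. Integration and Parseval bound the
  norm with exponent 1 below by \<open>sqrt (M / 2)\<close>, and the norm increases with
  \<open>q\<close>.\<close>

lemma C_lower_bound_Rudin_Shapiro:
  assumes N: "N \<ge> 1" and p: "1 \<le> p" and q: "1 \<le> q" and rp: "recip p \<le> 1 / 2"
  shows "ereal (1 / 2 * real N powr (1 / 2 - recip p)) \<le> C N p q"
proof -
  \<comment> \<open>The largest power of two up to \<open>N\<close>; a polynomial of that length is
    padded with zeros.\<close>
  obtain k where k: "2 ^ k \<le> N" "N < 2 ^ (k + 1)"
    using ex_power_ivl1[of 2 N] N by auto
  define M :: nat where "M = 2 ^ k"
  have M: "1 \<le> M" "M \<le> N" "N \<le> 2 * M" using k by (auto simp: M_def)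
  obtain a b where a: "\<And>n. n < M \<Longrightarrow> cmod (a n) = 1" "\<And>n. M \<le> n \<Longrightarrow> a n = 0"
    and sq: "\<And>t. (cmod (T M a t))\<^sup>2 + (cmod (T M b t))\<^sup>2 = 2 * real M"
    using Rudin_Shapiro[of k] unfolding M_def by auto
  have TN: "T N a = T M a"
    unfolding T_def using M a by (intro ext sum.mono_neutral_right) auto
  have sup: "cmod (T M a t) \<le> sqrt (2 * real M)" for t
    using sq[of t] by (intro real_le_rsqrt) (smt (verit) zero_le_power2)
  have "2 * pi * real M = integral {-pi..pi} (\<lambda>t. (cmod (T M a t))\<^sup>2)"
    using a by (simp add: Parseval[OF M(1)])
  also have "\<dots> \<le> integral {-pi..pi} (\<lambda>t. sqrt (2 * real M) * cmod (T M a t))"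
    using sup by (intro integral_le integrable_continuous_real continuous_intros)
      (auto simp: power2_eq_square mult_right_mono)
  finally have "2 * pi * real M \<le> sqrt (2 * real M) * integral {-pi..pi} (\<lambda>t. cmod (T M a t))"
    by simp
  moreover have "sqrt (2 * real M) * sqrt (real M / 2) = real M"
    by (simp flip: real_sqrt_mult)
  ultimately have "sqrt (2 * real M) * (2 * pi * sqrt (real M / 2))
      \<le> sqrt (2 * real M) * integral {-pi..pi} (\<lambda>t. cmod (T M a t))"
    by (simp add: mult_ac)
  then have "2 * pi * sqrt (real M / 2) \<le> integral {-pi..pi} (\<lambda>t. cmod (T M a t))"
    by (rule mult_left_le_imp_le) (use M in simp)
  then have "sqrt (real M / 2) \<le> fun_norm (ereal 1) (T N a)"
    by (intro fun_norm_geI) (simp_all add: TN)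
  also have "\<dots> \<le> fun_norm q (T N a)"
    using q by (intro fun_norm_mono continuous_intros) (simp_all add: one_ereal_def)
  finally have F: "sqrt (real M / 2) \<le> fun_norm q (T N a)" .
  \<comment> \<open>As \<open>recip p \<le> 1 / 2\<close>, the exponent is nonnegative and
    \<open>N\<close> may be replaced by \<open>2 * M\<close>. This costs at most
    \<open>sqrt 2\<close>, which with the factor \<open>sqrt (1 / 2)\<close> on the right gives the
    constant \<open>1 / 2\<close>.\<close>
  have "1 / 2 * real N powr (1 / 2 - recip p) * real M powr recip p \<le> sqrt (real M / 2)"
  proof -
    have "real N powr (1 / 2 - recip p) \<le> (2 * real M) powr (1 / 2 - recip p)"
      using M rp by (intro powr_mono2) auto
    also have "\<dots> = 2 powr (1 / 2 - recip p) * real M powr (1 / 2 - recip p)"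
      by (simp add: powr_mult)
    also have "\<dots> \<le> 2 powr (1 / 2) * real M powr (1 / 2 - recip p)"
      using recip_nonneg[OF p] by (intro mult_right_mono powr_mono) auto
    finally have "real N powr (1 / 2 - recip p) * real M powr recip p
      \<le> 2 powr (1 / 2) * real M powr (1 / 2 - recip p) * real M powr recip p"
      by (rule mult_right_mono) simp
    also have "\<dots> = sqrt 2 * sqrt (real M)"
      by (simp add: powr_half_sqrt mult.assoc flip: powr_add)
    also have "\<dots> = 2 * sqrt (real M / 2)"
    proof -
      have "sqrt (real M / 2) = sqrt 2 * sqrt (real M) / 2"
        by (rule real_sqrt_unique) (simp_all add: power_mult_distrib power_divide)
      then show ?thesis by simp
    qed
    finally show ?thesis by simp
  qed
  also note F
  also have "real M powr recip p = seq_norm N p a"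
    by (rule seq_norm_unimodular[OF M(1,2) p a, symmetric])
  finally have "1 / 2 * real N powr (1 / 2 - recip p) * seq_norm N p a \<le> fun_norm q (T N a)" .
  moreover have "a 0 \<noteq> 0" using a(1)[of 0] M by auto
  ultimately show ?thesis using M by (intro C_geI[of 0 N a]) auto
qed

section \<open>The three regions of exponents\<close>

theorem theorem2p3:
  shows "\<exists>cB cC :: real. cB > 0 \<and> cC > 0 \<and>
    (\<forall>(N::nat) (p::ereal) (q::ereal). 1 \<le> N \<longrightarrow> 1 \<le> p \<longrightarrow> 1 \<le> q \<longrightarrow>
      (1 / 2 \<le> recip p \<and> recip p \<le> 1 \<and> 1 - recip p \<le> recip q \<and> recip q \<le> 1 \<longrightarrow>
        C N p q = 1) \<and>
      (0 \<le> recip q \<and> recip q \<le> 1 / 2 \<and> 0 \<le> recip p \<and> recip p \<le> 1 - recip q \<longrightarrow>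
        ereal (cB * real N powr (1 - recip q - recip p)) \<le> C N p q \<and>
        C N p q \<le> ereal (real N powr (1 - recip q - recip p))) \<and>
      (0 \<le> recip p \<and> recip p \<le> 1 / 2 \<and> 1 / 2 \<le> recip q \<and> recip q \<le> 1 \<longrightarrow>
        ereal (cC * real N powr (1 / 2 - recip p)) \<le> C N p q \<and>
        C N p q \<le> ereal (real N powr (1 / 2 - recip p))))"
proof (rule exI[of _ "1 / (4 * pi)"], rule exI[of _ "1 / 2"], intro conjI allI impI)
  \<comment> \<open>The first constant comes from the Dirichlet kernel, the second from the
    Rudin--Shapiro polynomials.\<close>
  fix N :: nat and p q :: ereal
  assume N: "1 \<le> N" and p: "1 \<le> p" and q: "1 \<le> q"
  { assume r: "1 / 2 \<le> recip p \<and> recip p \<le> 1 \<and> 1 - recip p \<le> recip q \<and> recip q \<le> 1"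
    \<comment> \<open>The choice \<open>x = recip p\<close> makes the exponent of \<open>N\<close>
      vanish.\<close>
    have "C N p q \<le> ereal (real N powr (recip p - recip p))"
      using r by (intro C_upper_bound_recip N p q) auto
    then have "C N p q \<le> 1" using N by (simp add: one_ereal_def)
    with one_le_C[OF N p q] show "C N p q = 1" by (rule antisym[rotated]) }
  { assume r: "0 \<le> recip q \<and> recip q \<le> 1 / 2 \<and> 0 \<le> recip p \<and> recip p \<le> 1 - recip q"
    show "ereal (1 / (4 * pi) * real N powr (1 - recip q - recip p)) \<le> C N p q"
      by (rule C_lower_bound_Dirichlet[OF N p q])
    show "C N p q \<le> ereal (real N powr (1 - recip q - recip p))"
      using r by (intro C_upper_bound_recip N p q) auto }
  { assume r: "0 \<le> recip p \<and> recip p \<le> 1 / 2 \<and> 1 / 2 \<le> recip q \<and> recip q \<le> 1"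
    then show "ereal (1 / 2 * real N powr (1 / 2 - recip p)) \<le> C N p q"
      by (intro C_lower_bound_Rudin_Shapiro N p q) auto
    show "C N p q \<le> ereal (real N powr (1 / 2 - recip p))"
      using r by (intro C_upper_bound_recip N p q) auto }
qed auto

end
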